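(* (Policy Gradient Lemma) Let $\pi_\theta$ be an ergodic policy, parameterized by a vector $\theta$, with (unique) stationary distribution $\lambda_{\pi_\theta}$. Assume that $\pi_\theta(s,a)$, $\rho(\pi_\theta)$ and $Q_{\pi_\theta}(s,a)$ are differentiable with respect to the parameters $\theta$. Then $$\frac{\partial}{\partial\theta}\rho(\pi_\theta)=\sum_{s\in S}\lambda_{\pi_\theta}(s)\sum_{a\in A}\frac{\partial\pi_\theta(s,a)}{\partial\theta}\,Q_{\pi_\theta}(s,a).$$
   Context: Average reward dynamic programming. $S$ is a finite state space, $A$ a finite action set, $p(s,a,s')$ transition probabilities and $R:S\times A\times S\to\mathbb{R}$ a payoff function. A policy $\pi$ assigns to each $s\in S$ a probability measure $\pi(s,\cdot)$ on $A$; it generates the Markov chain on $S$ with kernel $K_\pi(s,s')=\sum_{a\in A}\pi(s,a)p(s,a,s')$. A policy is ergodic if this chain is irreducible and aperiodic; $\lambda_\pi$ denotes its unique stationary distribution. Standing assumption: all policies (in particular $\pi_\theta$ for all $\theta$ in the open parameter set) are ergodic. The average reward is $$\rho(\pi)=\lim_{T\to\infty}\frac1T\,\mathbb{E}_\pi\Big[\sum_{t=1}^TR(s(t),a(t),s(t+1))\Big]=\sum_{s,a,s'}\lambda_\pi(s)\pi(s,a)p(s,a,s')R(s,a,s').$$ The differential value function $h_\pi:S\to\mathbb{R}$ and the function $Q_\pi:S\times A\to\mathbb{R}$ satisfy $$h_\pi(s)=\sum_{a\in A}\pi(s,a)Q_\pi(s,a),\qquad Q_\pi(s,a)=\sum_{s'\in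 S}p(s,a,s')\big(R(s,a,s')-\rho(\pi)+h_\pi(s')\big)$$ (these equations determine $h_\pi$ up to an additive constant; any choice, differentiable in $\theta$ as assumed in the claim, is allowed). *)

theory Defs
  imports "HOL-Probability.Probability"
begin

text \<open>
  The state space is the finite type \<open>'s\<close>, the action set the finite type \<open>'a\<close>;
  \<open>p s a\<close> is the law of the next state, \<open>R s a s'\<close> the payoff, and a policy \<open>pol\<close> assigns to
  each state a probability measure on the actions.
\<close>

definition policy_kernel :: "('s::finite \<Rightarrow> 'a::finite \<Rightarrow> 's pmf) \<Rightarrow> ('s \<Rightarrow> 'a pmf) \<Rightarrow> 's \<Rightarrow> 's \<Rightarrow> real"
  where "policy_kernel p pol s s' = (\<Sum>a\<in>UNIV. pmf (pol s) a * pmf (p s a) s')"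

primrec kernel_pow :: "('s::finite \<Rightarrow> 's \<Rightarrow> real) \<Rightarrow> nat \<Rightarrow> 's \<Rightarrow> 's \<Rightarrow> real"
  where
    "kernel_pow K 0 s s' = (if s = s' then 1 else 0)"
  | "kernel_pow K (Suc n) s s' = (\<Sum>u\<in>UNIV. K s u * kernel_pow K n u s')"

definition irreducible_kernel :: "('s::finite \<Rightarrow> 's \<Rightarrow> real) \<Rightarrow> bool"
  where "irreducible_kernel K \<longleftrightarrow> (\<forall>s s'. \<exists>n. kernel_pow K n s s' > 0)"

definition aperiodic_kernel :: "('s::finite \<Rightarrow> 's \<Rightarrow> real) \<Rightarrow> bool"
  where "aperiodic_kernel K \<longleftrightarrow> (\<forall>s. Gcd {n. n > 0 \<and> kernel_pow K n s s > 0} = 1)"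

definition ergodic_policy :: "('s::finite \<Rightarrow> 'a::finite \<Rightarrow> 's pmf) \<Rightarrow> ('s \<Rightarrow> 'a pmf) \<Rightarrow> bool"
  where "ergodic_policy p pol \<longleftrightarrow>
    irreducible_kernel (policy_kernel p pol) \<and> aperiodic_kernel (policy_kernel p pol)"

definition is_stationary :: "('s::finite \<Rightarrow> 's \<Rightarrow> real) \<Rightarrow> 's pmf \<Rightarrow> bool"
  where "is_stationary K \<mu> \<longleftrightarrow> (\<forall>s'. (\<Sum>s\<in>UNIV. pmf \<mu> s * K s s') = pmf \<mu> s')"

text \<open>Well defined for ergodic policies; see \<open>stationary_ex1\<close> below.\<close>

definition stationary_dist :: "('s::finite \<Rightarrow> 'a::finite \<Rightarrow> 's pmf) \<Rightarrow> ('s \<Rightarrow> 'a pmf) \<Rightarrow> 's pmf"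
  where "stationary_dist p pol = (THE \<mu>. is_stationary (policy_kernel p pol) \<mu>)"

text \<open>
  The law of the first \<open>T\<close> transitions \<open>(s(t), a(t), s(t+1))\<close>, \<open>1 \<le> t \<le> T\<close>, of the controlled chain
  started in \<open>s(1) = s\<close>.
\<close>

primrec trajectory ::
  "('s::finite \<Rightarrow> 'a::finite \<Rightarrow> 's pmf) \<Rightarrow> ('s \<Rightarrow> 'a pmf) \<Rightarrow> nat \<Rightarrow> 's \<Rightarrow> ('s \<times> 'a \<times> 's) list pmf"
  where
    "trajectory p pol 0 s = return_pmf []"
  | "trajectory p pol (Suc T) s =
      bind_pmf (pol s) (\<lambda>a. bind_pmf (p s a) (\<lambda>s'. map_pmf ((#) (s, a, s')) (trajectory p pol T s')))"

definition expected_total_reward ::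
  "('s::finite \<Rightarrow> 'a::finite \<Rightarrow> 's pmf) \<Rightarrow> ('s \<Rightarrow> 'a \<Rightarrow> 's \<Rightarrow> real) \<Rightarrow> ('s \<Rightarrow> 'a pmf) \<Rightarrow> nat \<Rightarrow> 's \<Rightarrow> real"
  where "expected_total_reward p R pol T s =
    measure_pmf.expectation (trajectory p pol T s) (\<lambda>w. \<Sum>(x, a, y)\<leftarrow>w. R x a y)"

text \<open>
  The long-run average, required to be the same for every initial state. For ergodic policies it
  exists and is the stationary mean payoff; see \<open>average_reward_eq\<close> below.
\<close>

definition average_reward ::
  "('s::finite \<Rightarrow> 'a::finite \<Rightarrow> 's pmf) \<Rightarrow> ('s \<Rightarrow> 'a \<Rightarrow> 's \<Rightarrow> real) \<Rightarrow> ('s \<Rightarrow> 'a pmf) \<Rightarrow> real"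
  where "average_reward p R pol =
    (THE r. \<forall>s. (\<lambda>T. (1 / real T) * expected_total_reward p R pol T s) \<longlonglongrightarrow> r)"

text \<open>
  The two equations determine \<open>h\<close> only up to an additive constant, so this is a predicate.
\<close>

definition differential_value_functions ::
  "('s::finite \<Rightarrow> 'a::finite \<Rightarrow> 's pmf) \<Rightarrow> ('s \<Rightarrow> 'a \<Rightarrow> 's \<Rightarrow> real) \<Rightarrow> ('s \<Rightarrow> 'a pmf) \<Rightarrow>
    ('s \<Rightarrow> real) \<Rightarrow> ('s \<Rightarrow> 'a \<Rightarrow> real) \<Rightarrow> bool"
  where "differential_value_functions p R pol h Q \<longleftrightarrow>
    (\<forall>s. h s = (\<Sum>a\<in>UNIV. pmf (pol s) a * Q s a)) \<and>
    (\<forall>s a. Q s a = (\<Sum>s'\<in>UNIV. pmf (p s a) s' * (R s a s' - average_reward p R pol + h s')))"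


section \<open>Well-definedness\<close>

lemma policy_kernel_nonneg: "policy_kernel p pol s s' \<ge> 0"
  unfolding policy_kernel_def by (intro sum_nonneg mult_nonneg_nonneg) auto

lemma pmf_sum_UNIV: "(\<Sum>x\<in>UNIV. pmf M x) = 1" for M :: "'x::finite pmf"
  by (rule sum_pmf_eq_1) auto

lemma policy_kernel_sum: "(\<Sum>s'\<in>UNIV. policy_kernel p pol s s') = 1"
proof -
  have "(\<Sum>s'\<in>UNIV. policy_kernel p pol s s') =
      (\<Sum>a\<in>UNIV. pmf (pol s) a * (\<Sum>s'\<in>UNIV. pmf (p s a) s'))"
    unfolding policy_kernel_def sum_distrib_left by (rule sum.swap)
  then show ?thesis by (simp add: pmf_sum_UNIV)
qed

context
  fixes K :: "'s::finite \<Rightarrow> 's \<Rightarrow> real"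
  assumes K0: "\<And>s s'. K s s' \<ge> 0" and K1: "\<And>s. (\<Sum>s'\<in>UNIV. K s s') = 1"
begin

lemma kernel_pow_nonneg: "kernel_pow K n s s' \<ge> 0"
  by (induction n arbitrary: s) (auto intro!: sum_nonneg mult_nonneg_nonneg K0)

lemma kernel_pow_sum: "(\<Sum>s'\<in>UNIV. kernel_pow K n s s') = 1"
proof (induction n arbitrary: s)
  case (Suc n)
  have "(\<Sum>s'\<in>UNIV. kernel_pow K (Suc n) s s') =
      (\<Sum>u\<in>UNIV. K s u * (\<Sum>s'\<in>UNIV. kernel_pow K n u s'))"
    unfolding sum_distrib_left kernel_pow.simps by (rule sum.swap)
  with Suc show ?case by (simp add: K1)
qed simp

lemma kernel_pow_Suc_right:
  "kernel_pow K (Suc n) s s' = (\<Sum>u\<in>UNIV. kernel_pow K n s u * K u s')"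
proof (induction n arbitrary: s)
  case 0
  show ?case by (simp add: if_distrib if_distribR sum.delta sum.delta' cong: if_cong)
next
  case (Suc n)
  have "kernel_pow K (Suc (Suc n)) s s' = (\<Sum>v\<in>UNIV. K s v * kernel_pow K (Suc n) v s')"
    by simp
  also have "\<dots> = (\<Sum>v\<in>UNIV. \<Sum>u\<in>UNIV. K s v * kernel_pow K n v u * K u s')"
    by (subst Suc) (simp add: sum_distrib_left mult.assoc)
  also have "\<dots> = (\<Sum>u\<in>UNIV. \<Sum>v\<in>UNIV. K s v * kernel_pow K n v u * K u s')"
    by (rule sum.swap)
  also have "\<dots> = (\<Sum>u\<in>UNIV. kernel_pow K (Suc n) s u * K u s')"
    by (simp add: sum_distrib_right)
  finally show ?case .
qed

lemma stationary_kernel_pow: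
  assumes "\<And>s'. (\<Sum>s\<in>UNIV. f s * K s s') = f s'"
  shows "(\<Sum>s\<in>UNIV. f s * kernel_pow K n s s') = f s'"
proof (induction n arbitrary: s')
  case 0
  show ?case by (simp add: if_distrib if_distribR sum.delta sum.delta' cong: if_cong)
next
  case (Suc n)
  have "(\<Sum>s\<in>UNIV. f s * kernel_pow K (Suc n) s s') =
      (\<Sum>s\<in>UNIV. \<Sum>u\<in>UNIV. f s * K s u * kernel_pow K n u s')"
    by (simp add: sum_distrib_left mult.assoc)
  also have "\<dots> = (\<Sum>u\<in>UNIV. \<Sum>s\<in>UNIV. f s * K s u * kernel_pow K n u s')"
    by (rule sum.swap)
  also have "\<dots> = (\<Sum>u\<in>UNIV. f u * kernel_pow K n u s')"
    by (simp flip: sum_distrib_right add: assms)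
  also have "\<dots> = f s'" by (rule Suc)
  finally show ?case .
qed

lemma stationary_nonneg_zero:
  assumes irr: "irreducible_kernel K"
    and st: "\<And>s'. (\<Sum>s\<in>UNIV. f s * K s s') = f s'" and nn: "\<And>s. f s \<ge> 0" and z: "f z = 0"
  shows "f s = 0"
proof -
  obtain n where n: "kernel_pow K n s z > 0" using irr by (auto simp: irreducible_kernel_def)
  have "(\<Sum>s\<in>UNIV. f s * kernel_pow K n s z) = 0"
    using stationary_kernel_pow[OF st] z by simp
  then have "f s * kernel_pow K n s z = 0"
    by (subst (asm) sum_nonneg_eq_0_iff) (auto intro: mult_nonneg_nonneg nn kernel_pow_nonneg)
  with n show ?thesis by simp
qed

lemma stationary_unique:
  assumes irr: "irreducible_kernel K" and m: "is_stationary K m" and l: "is_stationary K l"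
  shows "m = l"
proof -
  have lpos: "pmf l s > 0" for s
  proof (rule ccontr)
    assume "\<not> pmf l s > 0"
    then have "pmf l s = 0" by (simp add: pmf_nonneg order.antisym not_less)
    then have "pmf l t = 0" for t
      using stationary_nonneg_zero[OF irr, of "pmf l" s t] l by (simp add: is_stationary_def)
    then show False using pmf_sum_UNIV[of l] by simp
  qed
  define c where "c = Min (range (\<lambda>s. pmf m s / pmf l s))"
  have "c \<in> range (\<lambda>s. pmf m s / pmf l s)" unfolding c_def by (rule Min_in) auto
  then obtain z where z: "c = pmf m z / pmf l z" by blast
  have cle: "c \<le> pmf m s / pmf l s" for s unfolding c_def by (rule Min_le) auto
  define f where "f s = pmf m s - c * pmf l s" for s
  have f0: "f s = 0" for s
  proof (rule stationary_nonneg_zero[OF irr])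
    show "(\<Sum>s\<in>UNIV. f s * K s s') = f s'" for s'
    proof -
      have "(\<Sum>s\<in>UNIV. f s * K s s') =
          (\<Sum>s\<in>UNIV. pmf m s * K s s') - c * (\<Sum>s\<in>UNIV. pmf l s * K s s')"
        unfolding f_def by (simp add: left_diff_distrib sum_subtractf sum_distrib_left mult.assoc)
      then show ?thesis using m l by (simp add: is_stationary_def f_def)
    qed
    show "f s \<ge> 0" for s using cle[of s] lpos[of s] by (simp add: f_def field_simps)
    show "f z = 0" using z lpos[of z] by (simp add: f_def)
  qed
  have eq: "pmf m s = c * pmf l s" for s using f0[of s] by (simp add: f_def)
  have "(\<Sum>s\<in>UNIV. pmf m s) = c * (\<Sum>s\<in>UNIV. pmf l s)" by (simp add: eq sum_distrib_left)
  then have "c = 1" by (simp add: pmf_sum_UNIV)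
  then show ?thesis using eq by (auto intro!: pmf_eqI)
qed

definition cesaro :: "'s \<Rightarrow> nat \<Rightarrow> real^'s"
  where "cesaro s T = (\<chi> u. (\<Sum>t<T. kernel_pow K t s u) / real T)"

lemma kernel_pow_le_1: "kernel_pow K n s u \<le> 1"
proof -
  have "kernel_pow K n s u \<le> (\<Sum>u\<in>UNIV. kernel_pow K n s u)"
    by (rule member_le_sum) (auto intro: kernel_pow_nonneg)
  then show ?thesis by (simp add: kernel_pow_sum)
qed

lemma cesaro_bounds: "cesaro s T $ u \<ge> 0" "cesaro s T $ u \<le> 1"
proof -
  have "(\<Sum>t<T. kernel_pow K t s u) \<le> (\<Sum>t<T. 1)" by (intro sum_mono kernel_pow_le_1)
  then show "cesaro s T $ u \<le> 1" by (cases "T = 0") (auto simp: cesaro_def field_simps)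
  show "cesaro s T $ u \<ge> 0"
    by (auto simp: cesaro_def intro!: divide_nonneg_nonneg sum_nonneg kernel_pow_nonneg)
qed

lemma cesaro_sum: "T > 0 \<Longrightarrow> (\<Sum>u\<in>UNIV. cesaro s T $ u) = 1"
proof -
  assume T: "T > 0"
  have "(\<Sum>u\<in>UNIV. cesaro s T $ u) = (\<Sum>t<T. \<Sum>u\<in>UNIV. kernel_pow K t s u) / real T"
    unfolding cesaro_def vec_lambda_beta
    by (subst sum.swap) (simp only: sum_divide_distrib)
  then show ?thesis using T by (simp add: kernel_pow_sum)
qed

lemma cesaro_defect:
  "(\<Sum>u\<in>UNIV. cesaro s T $ u * K u v) - cesaro s T $ v =
    (kernel_pow K T s v - kernel_pow K 0 s v) / real T"
proof -
  have "(\<Sum>u\<in>UNIV. cesaro s T $ u * K u v) =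
      (\<Sum>u\<in>UNIV. \<Sum>t<T. kernel_pow K t s u * K u v) / real T"
    by (simp add: cesaro_def sum_divide_distrib sum_distrib_right)
  also have "(\<Sum>u\<in>UNIV. \<Sum>t<T. kernel_pow K t s u * K u v) = (\<Sum>t<T. kernel_pow K (Suc t) s v)"
    by (subst sum.swap) (simp only: kernel_pow_Suc_right)
  finally have "(\<Sum>u\<in>UNIV. cesaro s T $ u * K u v) - cesaro s T $ v =
      (\<Sum>t<T. kernel_pow K (Suc t) s v - kernel_pow K t s v) / real T"
    by (simp only: cesaro_def vec_lambda_beta sum_subtractf diff_divide_distrib)
  then show ?thesis
    by (simp only: sum_lessThan_telescope[where f = "\<lambda>t. kernel_pow K t s v"])
qed

lemma cesaro_limit_point:
  assumes r: "strict_mono r" and lim: "(\<lambda>n. cesaro s (r n)) \<longlonglongrightarrow> l"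
  shows "\<exists>m. is_stationary K m \<and> (\<forall>u. pmf m u = l $ u)"
proof -
  have limu: "(\<lambda>n. cesaro s (r n) $ u) \<longlonglongrightarrow> l $ u" for u by (intro tendsto_intros lim)
  have nn: "l $ u \<ge> 0" for u
    by (rule LIMSEQ_le_const[OF limu]) (auto intro: cesaro_bounds)
  have "(\<lambda>n. \<Sum>u\<in>UNIV. cesaro s (r n) $ u) \<longlonglongrightarrow> (\<Sum>u\<in>UNIV. l $ u)"
    by (intro tendsto_sum limu)
  moreover have "\<forall>\<^sub>F n in sequentially. (\<Sum>u\<in>UNIV. cesaro s (r n) $ u) = 1"
    using eventually_gt_at_top[of 0]
  proof eventually_elim
    case (elim n)
    then have "r n > 0" using seq_suble[OF r, of n] by linarith
    then show ?case by (rule cesaro_sum)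
  qed
  ultimately have "(\<lambda>n. 1::real) \<longlonglongrightarrow> (\<Sum>u\<in>UNIV. l $ u)" by (rule Lim_transform_eventually)
  then have s1: "(\<Sum>u\<in>UNIV. l $ u) = 1" by (simp add: LIMSEQ_const_iff)
  have st: "(\<Sum>u\<in>UNIV. l $ u * K u v) = l $ v" for v
  proof -
    have "(\<lambda>n. (\<Sum>u\<in>UNIV. cesaro s (r n) $ u * K u v) - cesaro s (r n) $ v) \<longlonglongrightarrow>
        (\<Sum>u\<in>UNIV. l $ u * K u v) - l $ v"
      by (intro tendsto_intros limu)
    moreover have "(\<lambda>n. (\<Sum>u\<in>UNIV. cesaro s (r n) $ u * K u v) - cesaro s (r n) $ v) \<longlonglongrightarrow> 0"
    proof (rule Lim_null_comparison)
      show "(\<lambda>n. 1 / real (r n)) \<longlonglongrightarrow> 0"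
        using LIMSEQ_subseq_LIMSEQ[OF lim_1_over_n r] by (simp add: o_def)
      have "\<bar>kernel_pow K T s v - kernel_pow K 0 s v\<bar> \<le> 1" for T
        using kernel_pow_nonneg[of T s v] kernel_pow_le_1[of T s v] by auto
      then show "\<forall>\<^sub>F n in sequentially.
          norm ((\<Sum>u\<in>UNIV. cesaro s (r n) $ u * K u v) - cesaro s (r n) $ v) \<le> 1 / real (r n)"
        unfolding cesaro_defect by (intro always_eventually allI)
          (simp only: real_norm_def abs_divide abs_of_nat divide_right_mono of_nat_0_le_iff)
    qed
    ultimately show ?thesis using LIMSEQ_unique by fastforce
  qed
  define m where "m = embed_pmf (\<lambda>u. l $ u)"
  have "pmf m u = l $ u" for u unfolding m_def
    by (rule pmf_embed_pmf) (auto simp: nn nn_integral_count_space_finite s1)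
  then show ?thesis using st by (intro exI[of _ m]) (simp add: is_stationary_def)
qed

lemma cesaro_subseq:
  fixes q :: "nat \<Rightarrow> nat"
  obtains r l where "strict_mono r" "(\<lambda>n. cesaro s (q (r n))) \<longlonglongrightarrow> l"
proof -
  have "\<forall>n. cesaro s (q n) \<in> cbox 0 (\<chi> u. 1)"
    by (simp add: mem_box_cart cesaro_bounds)
  then have "\<exists>l\<in>cbox 0 (\<chi> u. 1). \<exists>r. strict_mono r \<and> ((\<lambda>n. cesaro s (q n)) \<circ> r) \<longlonglongrightarrow> l"
    by (rule compact_cbox[unfolded compact_def, THEN spec, THEN mp])
  then obtain l r where "strict_mono r" "((\<lambda>n. cesaro s (q n)) \<circ> r) \<longlonglongrightarrow> l"
    by blast
  then show ?thesis using that by (simp add: o_def)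
qed

lemma stationary_ex: "\<exists>m. is_stationary K m"
proof -
  obtain r l where "strict_mono r" "(\<lambda>n. cesaro undefined (r n)) \<longlonglongrightarrow> l"
    using cesaro_subseq[of undefined "\<lambda>n. n"] by auto
  from cesaro_limit_point[OF this] show ?thesis by blast
qed

lemma cesaro_tendsto:
  assumes irr: "irreducible_kernel K" and m: "is_stationary K m"
  shows "cesaro s \<longlonglongrightarrow> (\<chi> u. pmf m u)"
proof (rule ccontr)
  assume "\<not> ?thesis"
  then obtain e where e: "e > 0" "\<forall>N. \<exists>n\<ge>N. dist (cesaro s n) (\<chi> u. pmf m u) \<ge> e"
    by (auto simp: lim_sequentially not_less)
  then have inf: "infinite {n. dist (cesaro s n) (\<chi> u. pmf m u) \<ge> e}"
    by (simp add: infinite_nat_iff_unbounded_le)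
  define q where "q = enumerate {n. dist (cesaro s n) (\<chi> u. pmf m u) \<ge> e}"
  have q: "strict_mono q" "dist (cesaro s (q n)) (\<chi> u. pmf m u) \<ge> e" for n
    using strict_mono_enumerate[OF inf] enumerate_in_set[OF inf, of n] by (simp_all add: q_def)
  obtain r l where r: "strict_mono r" "(\<lambda>n. cesaro s (q (r n))) \<longlonglongrightarrow> l" by (rule cesaro_subseq)
  have "strict_mono (\<lambda>n. q (r n))" using strict_mono_o[OF q(1) r(1)] by (simp add: o_def)
  from cesaro_limit_point[OF this r(2)] obtain m' where
    m': "is_stationary K m'" "\<And>u. pmf m' u = l $ u" by blast
  have "m' = m" by (rule stationary_unique[OF irr m'(1) m])
  then have "l = (\<chi> u. pmf m u)" using m'(2) by (simp add: vec_eq_iff)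
  then obtain n where "dist (cesaro s (q (r n))) (\<chi> u. pmf m u) < e"
    using r(2) e(1) unfolding lim_sequentially by blast
  then show False using q(2)[of "r n"] by simp
qed

end

theorem stationary_ex1:
  assumes "ergodic_policy p pol"
  shows "\<exists>!\<mu>. is_stationary (policy_kernel p pol) \<mu>"
  using assms stationary_ex[where K = "policy_kernel p pol", OF policy_kernel_nonneg policy_kernel_sum]
    stationary_unique[where K = "policy_kernel p pol", OF policy_kernel_nonneg policy_kernel_sum]
  by (auto simp: ergodic_policy_def)

lemma is_stationary_stationary_dist:
  "ergodic_policy p pol \<Longrightarrow> is_stationary (policy_kernel p pol) (stationary_dist p pol)"
  unfolding stationary_dist_def by (rule theI') (rule stationary_ex1)

lemma finite_set_trajectory: "finite (set_pmf (trajectory p pol T s))"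
  by (induction T arbitrary: s) auto

lemma expected_total_reward_Suc:
  "expected_total_reward p R pol (Suc T) s =
    (\<Sum>a\<in>UNIV. pmf (pol s) a * (\<Sum>s'\<in>UNIV. pmf (p s a) s' * R s a s')) +
    (\<Sum>u\<in>UNIV. policy_kernel p pol s u * expected_total_reward p R pol T u)"
proof -
  let ?g = "\<lambda>w. \<Sum>(x, a, y)\<leftarrow>w. R x a y"
  have step: "measure_pmf.expectation (trajectory p pol T s') (\<lambda>w. R s a s' + ?g w) =
      R s a s' + expected_total_reward p R pol T s'" for a s'
    by (simp add: expected_total_reward_def integrable_measure_pmf_finite finite_set_trajectory)
  have "expected_total_reward p R pol (Suc T) s =
      (\<Sum>a\<in>UNIV. pmf (pol s) a * (\<Sum>s'\<in>UNIV. pmf (p s a) s' *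
        (R s a s' + expected_total_reward p R pol T s')))"
    unfolding expected_total_reward_def[of _ _ _ "Suc T"] trajectory.simps
    by (subst pmf_expectation_bind[where A = UNIV];
        (subst pmf_expectation_bind[where A = UNIV])?)
       (auto simp: step finite_set_trajectory)
  also have "\<dots> = (\<Sum>a\<in>UNIV. pmf (pol s) a * (\<Sum>s'\<in>UNIV. pmf (p s a) s' * R s a s')) +
      (\<Sum>a\<in>UNIV. \<Sum>u\<in>UNIV. pmf (pol s) a * pmf (p s a) u * expected_total_reward p R pol T u)"
    by (simp add: distrib_left sum.distrib sum_distrib_left mult.assoc)
  also have "(\<Sum>a\<in>UNIV. \<Sum>u\<in>UNIV. pmf (pol s) a * pmf (p s a) u * expected_total_reward p R pol T u) =
      (\<Sum>u\<in>UNIV. policy_kernel p pol s u * expected_total_reward p R pol T u)"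
    unfolding policy_kernel_def sum_distrib_right by (rule sum.swap)
  finally show ?thesis .
qed

lemma expected_total_reward_kernel_pow:
  "expected_total_reward p R pol T s =
    (\<Sum>t<T. \<Sum>u\<in>UNIV. kernel_pow (policy_kernel p pol) t s u *
      (\<Sum>a\<in>UNIV. pmf (pol u) a * (\<Sum>s'\<in>UNIV. pmf (p u a) s' * R u a s')))"
  (is "_ = (\<Sum>t<T. \<Sum>u\<in>UNIV. ?P t s u * ?r u)")
proof (induction T arbitrary: s)
  case 0
  show ?case by (simp add: expected_total_reward_def)
next
  case (Suc T)
  have "(\<Sum>t<Suc T. \<Sum>u\<in>UNIV. ?P t s u * ?r u) =
      ?r s + (\<Sum>t<T. \<Sum>u\<in>UNIV. \<Sum>v\<in>UNIV. policy_kernel p pol s v * (?P t v u * ?r u))"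
    by (simp only: sum.lessThan_Suc_shift)
       (simp add: if_distrib if_distribR sum.delta sum.delta' sum_distrib_right mult.assoc cong: if_cong)
  also have "(\<Sum>t<T. \<Sum>u\<in>UNIV. \<Sum>v\<in>UNIV. policy_kernel p pol s v * (?P t v u * ?r u)) =
      (\<Sum>t<T. \<Sum>v\<in>UNIV. \<Sum>u\<in>UNIV. policy_kernel p pol s v * (?P t v u * ?r u))"
    by (intro sum.cong refl sum.swap)
  also have "\<dots> = (\<Sum>v\<in>UNIV. \<Sum>t<T. \<Sum>u\<in>UNIV. policy_kernel p pol s v * (?P t v u * ?r u))"
    by (rule sum.swap)
  also have "\<dots> = (\<Sum>v\<in>UNIV. policy_kernel p pol s v * expected_total_reward p R pol T v)"
    by (simp only: sum_distrib_left Suc)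
  finally show ?case by (simp only: expected_total_reward_Suc)
qed

theorem average_reward_tendsto:
  assumes erg: "ergodic_policy p pol"
  shows "(\<lambda>T. (1 / real T) * expected_total_reward p R pol T s) \<longlonglongrightarrow>
    (\<Sum>s\<in>UNIV. \<Sum>a\<in>UNIV. \<Sum>s'\<in>UNIV. pmf (stationary_dist p pol) s * pmf (pol s) a * pmf (p s a) s' * R s a s')"
proof -
  let ?K = "policy_kernel p pol"
  let ?r = "\<lambda>u. \<Sum>a\<in>UNIV. pmf (pol u) a * (\<Sum>s'\<in>UNIV. pmf (p u a) s' * R u a s')"
  note ces = cesaro_def[where K = "policy_kernel p pol", OF policy_kernel_nonneg policy_kernel_sum]
  have eq: "(1 / real T) * expected_total_reward p R pol T s =
      (\<Sum>u\<in>UNIV. cesaro ?K s T $ u * ?r u)" for T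
  proof -
    let ?A = "\<lambda>u. \<Sum>t<T. kernel_pow ?K t s u"
    have "expected_total_reward p R pol T s =
        (\<Sum>u\<in>UNIV. \<Sum>t<T. kernel_pow ?K t s u * ?r u)"
      unfolding expected_total_reward_kernel_pow by (rule sum.swap)
    also have "\<dots> = (\<Sum>u\<in>UNIV. ?A u * ?r u)" by (simp only: sum_distrib_right)
    finally have "(1 / real T) * expected_total_reward p R pol T s =
        (\<Sum>u\<in>UNIV. (1 / real T) * (?A u * ?r u))" by (simp only: sum_distrib_left)
    also have "\<dots> = (\<Sum>u\<in>UNIV. cesaro ?K s T $ u * ?r u)"
      by (intro sum.cong refl) (simp only: ces vec_lambda_beta times_divide_eq_left mult_1)
    finally show ?thesis .
  qed
  have "cesaro ?K s \<longlonglongrightarrow> (\<chi> u. pmf (stationary_dist p pol) u)"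
    using erg is_stationary_stationary_dist[OF erg]
    by (intro cesaro_tendsto policy_kernel_nonneg policy_kernel_sum) (auto simp: ergodic_policy_def)
  then have "(\<lambda>T. cesaro ?K s T $ u) \<longlonglongrightarrow> pmf (stationary_dist p pol) u" for u
    by (auto dest: tendsto_vec_nth[of _ _ _ u])
  then have "(\<lambda>T. \<Sum>u\<in>UNIV. cesaro ?K s T $ u * ?r u) \<longlonglongrightarrow>
      (\<Sum>u\<in>UNIV. pmf (stationary_dist p pol) u * ?r u)"
    by (intro tendsto_intros)
  then show ?thesis by (simp only: eq sum_distrib_left mult.assoc)
qed

theorem average_reward_eq:
  assumes "ergodic_policy p pol"
  shows "average_reward p R pol =
    (\<Sum>s\<in>UNIV. \<Sum>a\<in>UNIV. \<Sum>s'\<in>UNIV. pmf (stationary_dist p pol) s * pmf (pol s) a * pmf (p s a) s' * R s a s')"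
  unfolding average_reward_def
  by (rule the_equality) (use average_reward_tendsto[OF assms] LIMSEQ_unique in blast)+

end

theory Submission
  imports Defs
begin

text \<open>
  The performance difference formula
  \<open>\<rho>(\<pi>') - \<rho>(\<pi>) = (\<Sum>s. \<lambda>\<^sub>\<pi> s * (\<Sum>a. (\<pi>' s a - \<pi> s a) * Q\<^sub>\<pi>\<^sub>' s a))\<close> involves the stationary
  distribution of \<open>\<pi>\<close> only. Put \<open>\<pi> = \<pi>\<^sub>\<theta>\<close> and \<open>\<pi>' = \<pi>\<^sub>\<eta>\<close> and differentiate in \<open>\<eta>\<close> at \<open>\<eta> = \<theta>\<close>:
  there the factor \<open>\<pi>\<^sub>\<eta> - \<pi>\<^sub>\<theta>\<close> vanishes, so the derivative of \<open>Q\<^sub>\<eta>\<close> drops out.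
\<close>

text \<open>The product rule at \<open>x\<close>: the term with the derivative of \<open>g\<close>
  carries the factor \<open>f x - f x\<close>, which is zero.\<close>

lemma has_derivative_increment_mult:
  fixes f g :: "'a::real_normed_vector \<Rightarrow> real"
  assumes f: "f differentiable (at x)" and g: "g differentiable (at x)"
  shows "((\<lambda>y. (f y - f x) * g y) has_derivative (\<lambda>v. frechet_derivative f (at x) v * g x)) (at x)"
proof -
  have "((\<lambda>y. f y - f x) has_derivative (\<lambda>v. frechet_derivative f (at x) v - 0)) (at x)"
    using f by (intro has_derivative_diff has_derivative_const) (simp only: frechet_derivative_works)
  from has_derivative_mult[OF this g[unfolded frechet_derivative_works]] show ?thesis by simp
qed

text \<open>Stationarity tested against a function: after exchanging the sums, the inner one is the
  balance equation at \<open>s'\<close>. It is applied to \<open>h\<close> below.\<close>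

lemma stationary_dist_policy_kernel_sum:
  assumes "ergodic_policy p pol"
  shows "(\<Sum>s\<in>UNIV. pmf (stationary_dist p pol) s * (\<Sum>s'\<in>UNIV. policy_kernel p pol s s' * f s')) =
    (\<Sum>s\<in>UNIV. pmf (stationary_dist p pol) s * f s)"
proof -
  let ?l = "pmf (stationary_dist p pol)" and ?K = "policy_kernel p pol"
  have "(\<Sum>s\<in>UNIV. ?l s * (\<Sum>s'\<in>UNIV. ?K s s' * f s')) =
      (\<Sum>s'\<in>UNIV. \<Sum>s\<in>UNIV. ?l s * (?K s s' * f s'))"
    unfolding sum_distrib_left by (rule sum.swap)
  also have "\<dots> = (\<Sum>s'\<in>UNIV. (\<Sum>s\<in>UNIV. ?l s * ?K s s') * f s')"
    by (simp only: sum_distrib_right mult.assoc)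
  also have "\<dots> = (\<Sum>s'\<in>UNIV. ?l s' * f s')"
    using is_stationary_stationary_dist[OF assms] by (simp only: is_stationary_def)
  finally show ?thesis .
qed

text \<open>The equation for \<open>Q\<close> sees \<open>pol'\<close> only through its average
  reward and \<open>h\<close>, so it may be averaged under any other policy \<open>pol\<close>;
  averaging the transition probabilities then produces the kernel of \<open>pol\<close>.\<close>

lemma policy_average_of_Q:
  assumes "differential_value_functions p R pol' h Q"
  shows "(\<Sum>a\<in>UNIV. pmf (pol s) a * Q s a) =
    (\<Sum>a\<in>UNIV. \<Sum>s'\<in>UNIV. pmf (pol s) a * pmf (p s a) s' * R s a s') -
    average_reward p R pol' + (\<Sum>s'\<in>UNIV. policy_kernel p pol s s' * h s')"
proof -
  let ?r = "average_reward p R pol'"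
  have Q: "Q s a = (\<Sum>s'\<in>UNIV. pmf (p s a) s' * R s a s') - ?r + (\<Sum>s'\<in>UNIV. pmf (p s a) s' * h s')"
    for a
  proof -
    have "Q s a = (\<Sum>s'\<in>UNIV. pmf (p s a) s' * (R s a s' - ?r + h s'))"
      using assms unfolding differential_value_functions_def by blast
    also have "\<dots> = (\<Sum>s'\<in>UNIV. pmf (p s a) s' * R s a s') - (\<Sum>s'\<in>UNIV. pmf (p s a) s') * ?r +
        (\<Sum>s'\<in>UNIV. pmf (p s a) s' * h s')"
      by (simp only: distrib_left right_diff_distrib sum.distrib sum_subtractf sum_distrib_right)
    finally show ?thesis by (simp add: pmf_sum_UNIV)
  qed
  have K: "(\<Sum>a\<in>UNIV. \<Sum>s'\<in>UNIV. pmf (pol s) a * (pmf (p s a) s' * h s')) =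
      (\<Sum>s'\<in>UNIV. policy_kernel p pol s s' * h s')"
    unfolding policy_kernel_def sum_distrib_right mult.assoc by (rule sum.swap)
  have "(\<Sum>a\<in>UNIV. pmf (pol s) a * Q s a) =
      (\<Sum>a\<in>UNIV. pmf (pol s) a * (\<Sum>s'\<in>UNIV. pmf (p s a) s' * R s a s')) -
      (\<Sum>a\<in>UNIV. pmf (pol s) a) * ?r +
      (\<Sum>a\<in>UNIV. pmf (pol s) a * (\<Sum>s'\<in>UNIV. pmf (p s a) s' * h s'))"
    by (simp only: Q distrib_left right_diff_distrib sum.distrib sum_subtractf sum_distrib_right)
  then show ?thesis
    by (simp add: pmf_sum_UNIV sum_distrib_left K mult.assoc)
qed

text \<open>Weighting by the stationary distribution of \<open>pol\<close> makes \<open>h\<close>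
  and its image under the kernel of \<open>pol\<close> cancel, and turns the one-step payoff into
  the average reward of \<open>pol\<close>.\<close>

lemma performance_difference:
  assumes erg: "ergodic_policy p pol"
    and dvf: "differential_value_functions p R pol' h Q"
  shows "average_reward p R pol' - average_reward p R pol =
    (\<Sum>s\<in>UNIV. pmf (stationary_dist p pol) s *
      (\<Sum>a\<in>UNIV. (pmf (pol' s) a - pmf (pol s) a) * Q s a))"
proof -
  let ?l = "pmf (stationary_dist p pol)" and ?r = "average_reward p R pol'"
  let ?g = "\<lambda>s. \<Sum>a\<in>UNIV. \<Sum>s'\<in>UNIV. pmf (pol s) a * pmf (p s a) s' * R s a s'"
  let ?Kh = "\<lambda>s. \<Sum>s'\<in>UNIV. policy_kernel p pol s s' * h s'"
  \<comment> \<open>The average of \<open>Q\<close> under its own policy \<open>pol'\<close> is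
    \<open>h s\<close>; the average under \<open>pol\<close> comes from
    \<open>policy_average_of_Q\<close>.\<close>
  have "(\<Sum>a\<in>UNIV. (pmf (pol' s) a - pmf (pol s) a) * Q s a) = h s - ?g s + ?r - ?Kh s" for s
  proof -
    have "h s = (\<Sum>a\<in>UNIV. pmf (pol' s) a * Q s a)"
      using dvf unfolding differential_value_functions_def by blast
    then show ?thesis
      unfolding left_diff_distrib sum_subtractf policy_average_of_Q[OF dvf, of pol s] by linarith
  qed
  then have "(\<Sum>s\<in>UNIV. ?l s * (\<Sum>a\<in>UNIV. (pmf (pol' s) a - pmf (pol s) a) * Q s a)) =
      (\<Sum>s\<in>UNIV. ?l s * h s) - (\<Sum>s\<in>UNIV. ?l s * ?g s) + (\<Sum>s\<in>UNIV. ?l s) * ?r -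
      (\<Sum>s\<in>UNIV. ?l s * ?Kh s)"
    by (simp only: distrib_left right_diff_distrib sum.distrib sum_subtractf sum_distrib_right)
  moreover have "(\<Sum>s\<in>UNIV. ?l s * ?g s) = average_reward p R pol"
    by (simp add: average_reward_eq[OF erg] sum_distrib_left mult.assoc)
  ultimately show ?thesis
    by (simp add: stationary_dist_policy_kernel_sum[OF erg] pmf_sum_UNIV)
qed

lemma has_derivative_average_reward:
  fixes \<pi> :: "'v::real_normed_vector \<Rightarrow> 's::finite \<Rightarrow> 'a::finite pmf"
  assumes op: "open \<Theta>" and \<theta>: "\<theta> \<in> \<Theta>" and erg: "ergodic_policy p (\<pi> \<theta>)"
    and dvf: "\<And>\<eta>. \<eta> \<in> \<Theta> \<Longrightarrow> differential_value_functions p R (\<pi> \<eta>) (h \<eta>) (Q \<eta>)"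
    and d\<pi>: "\<And>s a. (\<lambda>\<eta>. pmf (\<pi> \<eta> s) a) differentiable (at \<theta>)"
    and dQ: "\<And>s a. (\<lambda>\<eta>. Q \<eta> s a) differentiable (at \<theta>)"
  shows "((\<lambda>\<eta>. average_reward p R (\<pi> \<eta>)) has_derivative
    (\<lambda>v. \<Sum>s\<in>UNIV. pmf (stationary_dist p (\<pi> \<theta>)) s *
      (\<Sum>a\<in>UNIV. frechet_derivative (\<lambda>\<eta>. pmf (\<pi> \<eta> s) a) (at \<theta>) v * Q \<theta> s a))) (at \<theta>)"
    (is "(?\<rho> has_derivative ?D) _")
proof -
  \<comment> \<open>The weights stay frozen at \<open>\<theta>\<close> while \<open>\<eta>\<close>
    varies, so no derivative of the stationary distribution arises.\<close>
  let ?F = "\<lambda>\<eta>. ?\<rho> \<theta> + (\<Sum>s\<in>UNIV. pmf (stationary_dist p (\<pi> \<theta>)) s *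
    (\<Sum>a\<in>UNIV. (pmf (\<pi> \<eta> s) a - pmf (\<pi> \<theta> s) a) * Q \<eta> s a))"
  have "(?F has_derivative (\<lambda>v. 0 + ?D v)) (at \<theta>)"
    by (intro has_derivative_add has_derivative_const has_derivative_sum has_derivative_mult_right
        has_derivative_increment_mult d\<pi> dQ)
  moreover have "?F \<eta> = ?\<rho> \<eta>" if "\<eta> \<in> \<Theta>" for \<eta>
    using performance_difference[OF erg dvf[OF that]] by simp
  \<comment> \<open>\<open>?F\<close> and \<open>?\<rho>\<close> agree on \<open>\<Theta>\<close>,
    an open neighbourhood of \<open>\<theta>\<close>, hence share their derivative there.\<close>
  ultimately have "(?\<rho> has_derivative (\<lambda>v. 0 + ?D v)) (at \<theta>)"
    by (rule has_derivative_transform_within_open[OF _ op \<theta>])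
  then show ?thesis by simp
qed

theorem lemma4p3:
  fixes p :: "'s::finite \<Rightarrow> 'a::finite \<Rightarrow> 's pmf"
    and R :: "'s \<Rightarrow> 'a \<Rightarrow> 's \<Rightarrow> real"
    and \<Theta> :: "(real^'d) set"
    and \<pi> :: "real^'d \<Rightarrow> 's \<Rightarrow> 'a pmf"
    and h :: "real^'d \<Rightarrow> 's \<Rightarrow> real"
    and Q :: "real^'d \<Rightarrow> 's \<Rightarrow> 'a \<Rightarrow> real"
  assumes "open \<Theta>"
    and "\<And>\<theta>. \<theta> \<in> \<Theta> \<Longrightarrow> ergodic_policy p (\<pi> \<theta>)"
    and "\<And>\<theta>. \<theta> \<in> \<Theta> \<Longrightarrow> differential_value_functions p R (\<pi> \<theta>) (h \<theta>) (Q \<theta>)"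
    and "\<And>\<theta> s a. \<theta> \<in> \<Theta> \<Longrightarrow> (\<lambda>\<theta>. pmf (\<pi> \<theta> s) a) differentiable (at \<theta>)"
    and "\<And>\<theta>. \<theta> \<in> \<Theta> \<Longrightarrow> (\<lambda>\<theta>. average_reward p R (\<pi> \<theta>)) differentiable (at \<theta>)"
    and "\<And>\<theta> s a. \<theta> \<in> \<Theta> \<Longrightarrow> (\<lambda>\<theta>. Q \<theta> s a) differentiable (at \<theta>)"
  shows "\<forall>\<theta>\<in>\<Theta>. frechet_derivative (\<lambda>\<theta>. average_reward p R (\<pi> \<theta>)) (at \<theta>) =
    (\<lambda>v. \<Sum>s\<in>UNIV. pmf (stationary_dist p (\<pi> \<theta>)) s *
      (\<Sum>a\<in>UNIV. frechet_derivative (\<lambda>\<theta>. pmf (\<pi> \<theta> s) a) (at \<theta>) v * Q \<theta> s a))"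
  \<comment> \<open>Uniqueness of the derivative turns the explicit \<open>has_derivative\<close>
    statement into an equation.\<close>
  by (intro ballI frechet_derivative_at[symmetric]
    has_derivative_average_reward[where h = h, OF assms(1)] assms)

end
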